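(* Let $\ell\ge 2$ be an integer and let $(V^{\sf small},V^{\sf large})$ be an $\alpha$-valuation of the complete bipartite graph $K_{a,b}$, with $|V^{\sf small}|=a$ and $|V^{\sf large}|=b$, such that every element of $V^{\sf large}$ is a multiple of $\ell$ and $V^{\sf small}$ is a union of runs $R_i=\{i\ell,i\ell+1,\dots,i\ell+\ell-1\}$. Let $W^{\sf large}=\{y/\ell: y\in V^{\sf large}\}$, and let $W^{\sf small}$ be the set obtained by replacing each run $R_i=\{i\ell,\dots,i\ell+\ell-1\}\subseteq V^{\sf small}$ by the single element $i$. Then $(W^{\sf small},W^{\sf large})$ is an $\alpha$-valuation of $K_{a/\ell,b}$.
   Context: An $\alpha$-valuation of $K_{a,b}$ is a one-to-one labelling of its vertices by elements of $\{0,1,\dots,ab\}$ such that the absolute differences of endpoint labels over all edges are exactly $\{1,\dots,ab\}$, and there is a value $x$ such that every edge joins a vertex with label $\le x$ to a vertex with label $>x$. Vertices are identified with their labels; $V^{\sf small}$ is the set of labels $\le x$ and $V^{\sf large}$ the set of labels $>x$; equivalently, every element of $V^{\sf large}$ exceeds every element of $V^{\sf small}$ and the differences $u-z$ ($u\in V^{\sf large}$, $z\in V^{\sf small}$) are exactly $1,\dots,ab$, each once. *)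

theory Defs
  imports Main
begin

definition Kab_verts :: "nat \<Rightarrow> nat \<Rightarrow> (nat + nat) set" where
  "Kab_verts a b = {..<a} <+> {..<b}"

definition Kab_edges :: "nat \<Rightarrow> nat \<Rightarrow> (nat + nat) set set" where
  "Kab_edges a b = {{Inl i, Inr j} | i j. i < a \<and> j < b}"

text \<open>The threshold \<open>x\<close> is an integer, so that the small side may be empty when there are no edges.
  An edge may have either endpoint on the small side: \<open>K\<^bsub>a,b\<^esub>\<close> and \<open>K\<^bsub>b,a\<^esub>\<close> are the same graph.\<close>

definition Kab_alpha_labelling :: "nat \<Rightarrow> nat \<Rightarrow> (nat + nat \<Rightarrow> nat) \<Rightarrow> int \<Rightarrow> bool" where
  "Kab_alpha_labelling a b f x \<longleftrightarrow>
     inj_on f (Kab_verts a b) \<and>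
     f ` Kab_verts a b \<subseteq> {0..a * b} \<and>
     {\<bar>int (f u) - int (f v)\<bar> | u v. {u, v} \<in> Kab_edges a b} = {1..int (a * b)} \<and>
     (\<forall>e \<in> Kab_edges a b. \<exists>u v. e = {u, v} \<and> int (f u) \<le> x \<and> int (f v) > x)"

text \<open>Vertices are identified with their labels, so the valuation is given by its sets of small
  and of large labels.\<close>

definition Kab_alpha_valuation :: "nat \<Rightarrow> nat \<Rightarrow> nat set \<Rightarrow> nat set \<Rightarrow> bool" where
  "Kab_alpha_valuation a b Vsmall Vlarge \<longleftrightarrow>
     (\<exists>f x. Kab_alpha_labelling a b f x \<and>
        Vsmall = {y \<in> f ` Kab_verts a b. int y \<le> x} \<and>
        Vlarge = {y \<in> f ` Kab_verts a b. int y > x})"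

definition run :: "nat \<Rightarrow> nat \<Rightarrow> nat set" where
  "run l i = {i * l..<i * l + l}"

end

theory Submission
  imports Defs
begin

text \<open>If \<open>y = w l\<close> is a large label and \<open>i l + r\<close> with \<open>r < l\<close> a small one, their difference is
  \<open>(w - i) l - r\<close>. The differences coming from the pair \<open>(w, i)\<close> thus form the block of \<open>l\<close>
  consecutive integers ending in \<open>(w - i) l\<close>, and they exhaust \<open>{1..ab}\<close> exactly when the values
  \<open>w - i\<close> exhaust \<open>{1..ab/l}\<close>.\<close>

lemma edge_iff:
  "{u, v} \<in> Kab_edges a b \<longleftrightarrow>
     (\<exists>i<a. \<exists>j<b. u = Inl i \<and> v = Inr j \<or> u = Inr j \<and> v = Inl i)"
  unfolding Kab_edges_def by (auto simp: doubleton_eq_iff)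

text \<open>The threshold clause orients an edge without saying which end is small. Packing both
  orientations into one equivalence lets later arguments ignore which part of the graph carries the
  small labels.\<close>

lemma alpha_labelling_edge_sides:
  assumes "Kab_alpha_labelling a b f x" and "{u, v} \<in> Kab_edges a b"
  shows "int (f u) \<le> x \<longleftrightarrow> x < int (f v)"
proof -
  have "\<forall>e \<in> Kab_edges a b. \<exists>u v. e = {u, v} \<and> int (f u) \<le> x \<and> int (f v) > x"
    using assms(1) unfolding Kab_alpha_labelling_def by (elim conjE)
  from bspec[OF this assms(2)]
  obtain u' v' where "{u, v} = {u', v'}" "int (f u') \<le> x" "int (f v') > x"
    by (elim exE conjE)
  then show ?thesis
    by (auto simp: doubleton_eq_iff)
qed

text \<open>Two vertices of the same part have a common neighbour, vertex 0 of the other part, which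
  exists since \<open>a\<close> and \<open>b\<close> are positive. Both lie on the side of the
  threshold opposite to that neighbour, so the threshold cannot separate them.\<close>

lemma alpha_labelling_edgeI:
  assumes lab: "Kab_alpha_labelling a b f x"
    and verts: "u \<in> Kab_verts a b" "v \<in> Kab_verts a b"
    and uv: "int (f u) \<le> x" "x < int (f v)"
    and "a > 0" "b > 0"
  shows "{u, v} \<in> Kab_edges a b"
proof -
  note side = alpha_labelling_edge_sides[OF lab]
  have False if "u = Inl i" "v = Inl j" "i < a" "j < a" for i j
    using side[of u "Inr 0"] side[of v "Inr 0"] uv that \<open>b > 0\<close> by (auto simp: edge_iff)
  moreover have False if "u = Inr i" "v = Inr j" "i < b" "j < b" for i j
    using side[of u "Inl 0"] side[of v "Inl 0"] uv that \<open>a > 0\<close> by (auto simp: edge_iff)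
  ultimately show ?thesis
    using verts unfolding Kab_verts_def by (elim PlusE) (auto simp: edge_iff)
qed

text \<open>This moves the problem from graph labellings to plain sets of integers, where the
  division by \<open>l\<close> takes place. That each difference occurs only once needs no clause of
  its own: the \<open>a * b\<close> pairs in \<open>L\<close> \<times> \<open>S\<close> map onto
  \<open>a * b\<close> values.\<close>

lemma alpha_valuation_iff:
  assumes "card S = a" and "card L = b" and fin: "finite S" "finite L"
  shows "Kab_alpha_valuation a b S L \<longleftrightarrow>
     (\<exists>x. (\<forall>z\<in>S. int z \<le> x) \<and> (\<forall>u\<in>L. x < int u)) \<and> S \<union> L \<subseteq> {0..a * b} \<and>
     {int u - int z | u z. u \<in> L \<and> z \<in> S} = {1..int (a * b)}"
    (is "_ \<longleftrightarrow> ?sep \<and> ?bound \<and> ?diff")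
proof
  assume "Kab_alpha_valuation a b S L"
  then obtain f x where lab: "Kab_alpha_labelling a b f x"
    and S: "S = {y \<in> f ` Kab_verts a b. int y \<le> x}"
    and L: "L = {y \<in> f ` Kab_verts a b. int y > x}"
    unfolding Kab_alpha_valuation_def by blast
  have diff: "{\<bar>int (f u) - int (f v)\<bar> | u v. {u, v} \<in> Kab_edges a b} = {1..int (a * b)}"
    and bound: "f ` Kab_verts a b \<subseteq> {0..a * b}"
    using lab unfolding Kab_alpha_labelling_def by auto
  have "{\<bar>int (f u) - int (f v)\<bar> | u v. {u, v} \<in> Kab_edges a b}
      = {int u - int z | u z. u \<in> L \<and> z \<in> S}" (is "?E = ?D")
  proof (intro equalityI subsetI)
    fix d assume "d \<in> ?E"
    then obtain u v where uv: "{u, v} \<in> Kab_edges a b" and d: "d = \<bar>int (f u) - int (f v)\<bar>"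
      by blast
    from uv have "u \<in> Kab_verts a b" "v \<in> Kab_verts a b"
      by (auto simp: edge_iff Kab_verts_def)
    \<comment> \<open>Either end of the edge may be the small one, but in both cases the absolute
      value is the large label minus the small one.\<close>
    with alpha_labelling_edge_sides[OF lab uv]
    have "(f u \<in> S \<and> f v \<in> L \<and> f u < f v) \<or> (f v \<in> S \<and> f u \<in> L \<and> f v < f u)"
      unfolding S L by auto
    then show "d \<in> ?D"
      unfolding d by force
  next
    fix d assume "d \<in> ?D"
    then obtain u z where uz: "u \<in> L" "z \<in> S" and d: "d = int u - int z"
      by blast
    then have "a > 0" "b > 0"
      using assms by (auto simp: card_gt_0_iff)
    obtain p q where p: "p \<in> Kab_verts a b" "z = f p" "int (f p) \<le> x"
      and q: "q \<in> Kab_verts a b" "u = f q" "x < int (f q)"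
      using uz unfolding S L by blast
    have "{p, q} \<in> Kab_edges a b"
      using alpha_labelling_edgeI[OF lab p(1) q(1) p(3) q(3) \<open>a > 0\<close> \<open>b > 0\<close>] .
    moreover have "d = \<bar>int (f p) - int (f q)\<bar>"
      using d p q by simp
    ultimately show "d \<in> ?E"
      by blast
  qed
  with diff have ?diff by simp
  moreover have ?sep ?bound
    using bound unfolding S L by auto
  ultimately show "?sep \<and> ?bound \<and> ?diff" by blast
next
  assume R: "?sep \<and> ?bound \<and> ?diff"
  from R[THEN conjunct1] obtain x where xS: "\<And>z. z \<in> S \<Longrightarrow> int z \<le> x" and xL: "\<And>u. u \<in> L \<Longrightarrow> x < int u"
    by blast
  \<comment> \<open>For the labelling, enumerate \<open>S\<close> along the left part and
    \<open>L\<close> along the right part. The threshold keeps the two images disjoint, so the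
    combined map is injective.\<close>
  obtain g where g: "bij_betw g {..<a} S"
    using ex_bij_betw_nat_finite[OF \<open>finite S\<close>] assms by (auto simp: lessThan_atLeast0)
  obtain h where h: "bij_betw h {..<b} L"
    using ex_bij_betw_nat_finite[OF \<open>finite L\<close>] assms by (auto simp: lessThan_atLeast0)
  define f where "f = case_sum g h"
  have f [simp]: "f (Inl i) = g i" "f (Inr j) = h j" for i j
    by (simp_all add: f_def)
  have gS: "g ` {..<a} = S" and hL: "h ` {..<b} = L"
    using g h by (auto simp: bij_betw_def)
  have gx: "int (g i) \<le> x" if "i < a" for i
    using gS xS that by blast
  have hx: "x < int (h j)" if "j < b" for j
    using hL xL that by blast
  have img: "f ` Kab_verts a b = S \<union> L"
    unfolding Kab_verts_def Plus_def image_Un image_image f gS hL ..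
  have inj: "inj_on f (Kab_verts a b)"
  proof (rule inj_onI)
    fix u v assume "u \<in> Kab_verts a b" "v \<in> Kab_verts a b" "f u = f v"
    moreover have "g i \<noteq> h j" if "i < a" "j < b" for i j
      using gx[OF that(1)] hx[OF that(2)] by auto
    ultimately show "u = v"
      using g h unfolding Kab_verts_def bij_betw_def
      by (elim PlusE) (auto dest: inj_onD, metis)
  qed
  have "{\<bar>int (f u) - int (f v)\<bar> | u v. {u, v} \<in> Kab_edges a b}
      = {int u - int z | u z. u \<in> L \<and> z \<in> S}" (is "?E = ?D")
  proof (intro equalityI subsetI)
    fix d assume "d \<in> ?E"
    then obtain i j where ij: "i < a" "j < b"
      and "d = \<bar>int (g i) - int (h j)\<bar> \<or> d = \<bar>int (h j) - int (g i)\<bar>"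
      by (auto simp: edge_iff)
    then have "d = int (h j) - int (g i)"
      using gx[of i] hx[of j] by auto
    then show "d \<in> ?D"
      using ij gS hL by blast
  next
    fix d assume "d \<in> ?D"
    then obtain i j where ij: "i < a" "j < b" and "d = int (h j) - int (g i)"
      using gS hL by blast
    then have "d = \<bar>int (f (Inl i)) - int (f (Inr j))\<bar>"
      using gx[of i] hx[of j] by auto
    moreover have "{Inl i, Inr j} \<in> Kab_edges a b"
      using ij by (simp add: edge_iff)
    ultimately show "d \<in> ?E"
      by blast
  qed
  moreover have "\<exists>u v. e = {u, v} \<and> int (f u) \<le> x \<and> int (f v) > x"
    if "e \<in> Kab_edges a b" for e
  proof -
    obtain i j where "e = {Inl i, Inr j}" "i < a" "j < b"
      using \<open>e \<in> Kab_edges a b\<close> unfolding Kab_edges_def by blast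
    then show ?thesis
      using gx[of i] hx[of j] by (intro exI[of _ "Inl i"] exI[of _ "Inr j"]) simp
  qed
  ultimately have "Kab_alpha_labelling a b f x"
    using R inj img unfolding Kab_alpha_labelling_def by auto
  moreover have "S = {y \<in> f ` Kab_verts a b. int y \<le> x}" "L = {y \<in> f ` Kab_verts a b. int y > x}"
    unfolding img using xS xL by force+
  ultimately show "Kab_alpha_valuation a b S L"
    unfolding Kab_alpha_valuation_def by blast
qed

text \<open>Runs are the fibres of division by \<open>l\<close>; hence distinct runs are disjoint,
  and each number lies in exactly one.\<close>

lemma mem_run_iff:
  assumes "l > 0"
  shows "y \<in> run l i \<longleftrightarrow> y div l = i"
  using div_nat_eqI[of l i y] dividend_less_div_times[OF assms, of y]
  unfolding run_def by (auto simp: mult.commute add.commute)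

lemma card_Union_runs:
  assumes "l > 0" and "finite I"
  shows "card (\<Union>i\<in>I. run l i) = l * card I"
proof -
  have "card (\<Union>i\<in>I. run l i) = (\<Sum>i\<in>I. card (run l i))"
    using assms by (intro card_UN_disjoint) (auto simp: mem_run_iff, simp add: run_def)
  then show ?thesis
    by (simp add: run_def)
qed

text \<open>A union of runs determines its index set. This identifies the indices given by the
  hypothesis on \<open>Vsmall\<close> with \<open>Wsmall\<close>, which is defined by containment of
  runs.\<close>

lemma run_subset_Union_iff:
  assumes "l > 0"
  shows "run l i \<subseteq> (\<Union>i\<in>I. run l i) \<longleftrightarrow> i \<in> I"
proof
  assume "run l i \<subseteq> (\<Union>i\<in>I. run l i)"
  moreover have "i * l \<in> run l i"
    using assms by (simp add: run_def)
  ultimately obtain j where "j \<in> I" "i * l \<in> run l j"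
    by blast
  then show "i \<in> I"
    using assms by (simp add: mem_run_iff)
qed blast

theorem theorem2p11:
  fixes l a b :: nat and Vsmall Vlarge Wsmall Wlarge :: "nat set"
  assumes "l \<ge> 2"
    and "Kab_alpha_valuation a b Vsmall Vlarge"
    and "card Vsmall = a" and "card Vlarge = b"
    and "\<forall>y \<in> Vlarge. l dvd y"
    and "\<exists>I. Vsmall = (\<Union>i\<in>I. run l i)"
    and "Wlarge = {y div l | y. y \<in> Vlarge}"
    and "Wsmall = {i. run l i \<subseteq> Vsmall}"
  shows "l dvd a \<and> Kab_alpha_valuation (a div l) b Wsmall Wlarge \<and>
         card Wsmall = a div l \<and> card Wlarge = b"
proof -
  have l: "l > 0" using assms(1) by simp
  obtain I where "Vsmall = (\<Union>i\<in>I. run l i)"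
    using assms(6) by blast
  moreover from this have "Wsmall = I"
    unfolding assms(8) using run_subset_Union_iff[OF l] by auto
  ultimately have Vs: "Vsmall = (\<Union>i\<in>Wsmall. run l i)"
    by simp
  have "finite (Kab_verts a b)"
    by (simp add: Kab_verts_def)
  then have fin: "finite Vsmall" "finite Vlarge"
    using assms(2) unfolding Kab_alpha_valuation_def by auto
  have memS: "y \<in> Vsmall \<longleftrightarrow> y div l \<in> Wsmall" for y
    unfolding Vs using l by (auto simp: mem_run_iff)
  have "Wsmall \<subseteq> (\<lambda>y. y div l) ` Vsmall"
  proof
    fix i assume "i \<in> Wsmall"
    then show "i \<in> (\<lambda>y. y div l) ` Vsmall"
      using memS[of "i * l"] l by (intro image_eqI[of _ _ "i * l"]) simp_all
  qed
  then have finW: "finite Wsmall" "finite Wlarge"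
    using fin finite_subset unfolding assms(7) by auto
  \<comment> \<open>\<open>q\<close> will be the quotient of \<open>a\<close> by \<open>l\<close>.
    Defining it as a cardinality makes the divisibility of \<open>a\<close> a result of counting the
    runs.\<close>
  define q where "q = card Wsmall"
  have a: "a = l * q"
    using card_Union_runs[OF l finW(1)] assms(3) unfolding Vs q_def by simp
  have Vl: "Vlarge = (\<lambda>w. l * w) ` Wlarge"
    using assms(5) l unfolding assms(7) by (force simp: image_iff)
  have cardL: "card Wlarge = b"
    using assms(4) l unfolding Vl by (subst (asm) card_image) (auto simp: inj_on_def)
  note V = alpha_valuation_iff[OF assms(3,4) fin, THEN iffD1, OF assms(2)]
  from V[THEN conjunct1] obtain x where x: "\<And>z. z \<in> Vsmall \<Longrightarrow> int z \<le> x" "\<And>u. u \<in> Vlarge \<Longrightarrow> x < int u"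
    by blast
  have bound: "Vsmall \<union> Vlarge \<subseteq> {0..a * b}"
    and diff: "{int u - int z | u z. u \<in> Vlarge \<and> z \<in> Vsmall} = {1..int (a * b)}"
    using V by simp_all
  \<comment> \<open>The ends of a run give its extreme differences to a large label
    \<open>l * w\<close>. With \<open>d = w - i\<close> these are \<open>l * d\<close>, used to
    bound \<open>d\<close> above, and \<open>l * d - (l - 1)\<close>, used to show that
    \<open>d\<close> is positive.\<close>
  have first: "l * i \<in> Vsmall" and last: "l * i + (l - 1) \<in> Vsmall" if "i \<in> Wsmall" for i
    using that l div_mult_self2[of l "l - 1" i]
    by (simp_all add: memS add.commute del: add_diff_assoc add_diff_assoc2)
  \<comment> \<open>The new threshold is the floor of \<open>x / l\<close>. Integer
    \<open>div\<close> rounds down for negative \<open>x\<close> too, so \<open>l * i\<close> \<le>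
    \<open>x\<close> gives \<open>i\<close> \<le> \<open>x div l\<close>, and \<open>x\<close> <
    \<open>l * w\<close> gives \<open>x div l\<close> < \<open>w\<close>.\<close>
  have "int i \<le> x div int l" if "i \<in> Wsmall" for i
    using x(1)[OF first[OF that]] zdiv_mono1[of "int l * int i" x "int l"] l by simp
  moreover have "x div int l < int w" if "w \<in> Wlarge" for w
  proof -
    have "x < int l * int w"
      using x(2)[of "l * w"] that Vl by auto
    then show ?thesis
      using l pos_mod_sign[of "int l" x] mult_div_mod_eq[of "int l" x]
      by (smt (verit) mult_less_cancel_left_pos of_nat_0_less_iff)
  qed
  moreover have "Wsmall \<union> Wlarge \<subseteq> {0..q * b}"
  proof
    fix w assume "w \<in> Wsmall \<union> Wlarge"
    then have "l * w \<in> {0..a * b}"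
      using first Vl bound by blast
    then show "w \<in> {0..q * b}"
      using l unfolding a by (simp add: mult.assoc)
  qed
  moreover have "{int w - int i | w i. w \<in> Wlarge \<and> i \<in> Wsmall} = {1..int (q * b)}"
    (is "?D = _")
  proof (intro equalityI subsetI)
    fix d assume "d \<in> ?D"
    then obtain w i where w: "w \<in> Wlarge" and i: "i \<in> Wsmall" and d: "d = int w - int i"
      by blast
    have D: "int (l * w) - int z \<in> {1..int (a * b)}" if "z \<in> Vsmall" for z
      using diff that w Vl by blast
    have "int l * d \<le> int l * int (q * b)"
      using D[OF first[OF i]] unfolding a d by (simp add: algebra_simps)
    moreover have "int (l * w) - int (l * i) > 0"
      using D[OF last[OF i]] by simp
    then have "int l * d > 0"
      unfolding d by (simp add: right_diff_distrib)
    ultimately show "d \<in> {1..int (q * b)}"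
      using l by (auto simp: zero_less_mult_iff)
  next
    fix d assume d: "d \<in> {1..int (q * b)}"
    \<comment> \<open>To realise \<open>d\<close>, realise \<open>l * d\<close> in the old valuation
      as \<open>l * w - z\<close>. Then \<open>z\<close> is a multiple of \<open>l\<close>, so it
      starts its run, and the index of that run is \<open>w - d\<close>.\<close>
    then have "0 < int l * d" "int l * d \<le> int l * int (q * b)"
      using l by (auto intro!: mult_left_mono)
    then have "int l * d \<in> {1..int (a * b)}"
      unfolding a by (simp add: mult.assoc)
    then obtain w z where w: "w \<in> Wlarge" and z: "z \<in> Vsmall"
      and eq: "int l * d = int (l * w) - int z"
      using diff unfolding Vl by blast
    have "int z = int l * (int w - d)"
      using eq by (simp add: algebra_simps)
    then have "int (z div l) = int w - d"
      using l by (simp add: zdiv_int)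
    moreover have "z div l \<in> Wsmall"
      using z memS by simp
    ultimately show "d \<in> ?D"
      using w by force
  qed
  ultimately have "Kab_alpha_valuation q b Wsmall Wlarge"
    unfolding alpha_valuation_iff[OF q_def[symmetric] cardL finW]
    by (intro conjI exI[of _ "x div int l"] ballI)
  then show ?thesis
    using a l cardL q_def by simp
qed

end
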